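(* Let $(\mathfrak{A},\omega,\tau,K)$ be a $\ast$-dynamical system, where $K$ is a Borel measurable subsemigroup of a locally compact Hausdorff group $G$ with right Haar measure $\mu$, and assume that $G$ is unimodular (i.e. $\mu$ is also a left Haar measure). Let $\{\Lambda_{\alpha}\}$ be a space-filling net in $K$. Then for any $A,B\in\mathfrak{A}$ and $\varepsilon>0$ there exists an $\alpha_{0}$ such that $$\left|\frac{1}{\mu(\Lambda_{\alpha_{0}})}\int_{h\Lambda_{\alpha_{0}}}\omega(A^{\ast}\tau_{g}(B))\,d\mu(g)\right|>\left|\lim_{\alpha}\frac{1}{\mu(\Lambda_{\alpha})}\int_{\Lambda_{\alpha}}\omega(A^{\ast}\tau_{g}(B))\,d\mu(g)\right|-\varepsilon$$ for all $h\in K$ (the existence of the limit on the right being part of the assertion).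
   Context: A subsemigroup of a group $G$ is a subset $K\subset G$ (with $K=G$ allowed) such that $gh\in K$ for all $g,h\in K$. $\ast$-dynamical system: Let $\omega$ be a state on a (complex) unital $\ast$-algebra $\mathfrak{A}$, i.e. a linear functional with $\omega(A^{\ast}A)\geq 0$ for all $A\in\mathfrak{A}$ and $\omega(1)=1$. Let $G$ be a locally compact Hausdorff group with right Haar measure $\mu$, and $K$ a Borel measurable subsemigroup of $G$. Let $L(\mathfrak{A})$ be the space of linear operators $\mathfrak{A}\to\mathfrak{A}$, and let $\tau:K\rightarrow L(\mathfrak{A}):g\mapsto\tau_{g}$ satisfy $\tau_{g}\circ\tau_{h}=\tau_{gh}$, $\tau_{g}(1)=1$ and $\omega(\tau_{g}(A)^{\ast}\tau_{g}(A))\leq\omega(A^{\ast}A)$ for all $g,h\in K$ and $A\in\mathfrak{A}$, and be such that $K\ni g\mapsto\omega(A^{\ast}\tau_{g}(B))$ is Borel measurable for all $A,B\in\mathfrak{A}$. Then $(\mathfrak{A},\omega,\tau,K)$ is called a $\ast$-dynamical system. A net $\{\Lambda_{\alpha}\}$ is a family of subsets of $G$ indexed by a directed set. A net $\{\Lambda_{\alpha}\}$ of Borel subsets of $G$ is called space-filling in $K$ if $\Lambda_{\alpha}\subset K$ and $\mu(\Lambda_{\alpha})<\infty$ for all $\alpha$, $\mu(\Lambda_{\alpha})>0$ for all $\alpha$ large enough (i.e. for all $\alpha\geq\alpha_{1}$, for some $\alpha_{1}$), and $$\lim_{\alpha}\frac{\mu(\Lambda_{\alpha}\Delta(\Lambda_{\alpha}g))}{\mu(\Lambda_{\alpha})}=0$$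 for all $g\in K$, where $A\Delta B:=(A\cup B)\setminus(A\cap B)$, $\Lambda g:=\{kg:k\in\Lambda\}$ and $h\Lambda:=\{hk:k\in\Lambda\}$. Whenever $1/\mu(\Lambda_{\alpha_0})$ is written, it is understood that $\mu(\Lambda_{\alpha_0})>0$. *)

theory Defs
  imports "HOL-Analysis.Analysis" "HOL-Library.Complex_Order"
begin

text \<open>
  Groups are types of class \<^class>\<open>topological_group_add\<close>. This class does not assume
  commutativity; as usual in the library the group operation is nevertheless written
  additively, so the product \<open>gh\<close> is \<open>g + h\<close>, and \<open>\<Lambda>g\<close> and \<open>h\<Lambda>\<close> are
  \<open>(\<lambda>k. k + g) ` \<Lambda>\<close> and \<open>(\<lambda>k. h + k) ` \<Lambda>\<close>.
\<close>


subsection \<open>Haar measures\<close>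

text \<open>Radon measures in the sense of Folland: inner regularity is required on open sets only,
  since Haar measures of groups that are not \<open>\<sigma>\<close>-compact need not have it on all Borel sets.\<close>

definition radon_measure :: "'g::t2_space measure \<Rightarrow> bool" where
  "radon_measure M \<longleftrightarrow>
     sets M = sets borel \<and>
     (\<forall>C. compact C \<longrightarrow> emeasure M C < \<infinity>) \<and>
     (\<forall>B\<in>sets borel. emeasure M B = (INF U\<in>{U. open U \<and> B \<subseteq> U}. emeasure M U)) \<and>
     (\<forall>U. open U \<longrightarrow> emeasure M U = (SUP C\<in>{C. compact C \<and> C \<subseteq> U}. emeasure M C))"

definition right_haar_measure :: "'g::{topological_group_add,t2_space} measure \<Rightarrow> bool" where
  "right_haar_measure M \<longleftrightarrow> radon_measure M \<and> emeasure M UNIV \<noteq> 0 \<and>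
     (\<forall>g. \<forall>B\<in>sets borel. emeasure M ((\<lambda>k. k + g) ` B) = emeasure M B)"

definition left_haar_measure :: "'g::{topological_group_add,t2_space} measure \<Rightarrow> bool" where
  "left_haar_measure M \<longleftrightarrow> radon_measure M \<and> emeasure M UNIV \<noteq> 0 \<and>
     (\<forall>g. \<forall>B\<in>sets borel. emeasure M ((\<lambda>k. g + k) ` B) = emeasure M B)"


subsection \<open>\<open>*\<close>-dynamical systems\<close>

definition subsemigroup :: "'g::group_add set \<Rightarrow> bool" where
  "subsemigroup K \<longleftrightarrow> (\<forall>g\<in>K. \<forall>h\<in>K. g + h \<in> K)"

locale unital_star_algebra = vector_space scale
  for scale :: "complex \<Rightarrow> 'a::ring_1 \<Rightarrow> 'a" +
  fixes adj :: "'a \<Rightarrow> 'a"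
  assumes scale_mult_left: "scale c x * y = scale c (x * y)"
    and scale_mult_right: "x * scale c y = scale c (x * y)"
    and adj_add: "adj (x + y) = adj x + adj y"
    and adj_scale: "adj (scale c x) = scale (cnj c) (adj x)"
    and adj_mult: "adj (x * y) = adj y * adj x"
    and adj_adj: "adj (adj x) = x"

text \<open>The order on \<^typ>\<open>complex\<close> is that of \<^theory>\<open>HOL-Library.Complex_Order\<close>:
  \<open>z \<le> w\<close> means that \<open>w - z\<close> is a nonnegative real number.\<close>

locale star_algebra_state = unital_star_algebra scale adj
  for scale :: "complex \<Rightarrow> 'a::ring_1 \<Rightarrow> 'a" and adj :: "'a \<Rightarrow> 'a" +
  fixes \<omega> :: "'a \<Rightarrow> complex"
  assumes state_linear: "Vector_Spaces.linear scale (*) \<omega>"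
    and state_nonneg: "0 \<le> \<omega> (adj A * A)"
    and state_one: "\<omega> 1 = 1"

text \<open>The map \<open>\<tau>\<close> is only constrained on \<open>K\<close>.\<close>

locale star_dynamical_system = star_algebra_state scale adj \<omega>
  for scale :: "complex \<Rightarrow> 'a::ring_1 \<Rightarrow> 'a" and adj :: "'a \<Rightarrow> 'a" and \<omega> :: "'a \<Rightarrow> complex" +
  fixes \<tau> :: "'g::{topological_group_add,t2_space} \<Rightarrow> 'a \<Rightarrow> 'a" and K :: "'g set"
  assumes K_borel: "K \<in> sets borel"
    and K_subsemigroup: "subsemigroup K"
    and \<tau>_linear: "g \<in> K \<Longrightarrow> Vector_Spaces.linear scale scale (\<tau> g)"
    and \<tau>_comp: "g \<in> K \<Longrightarrow> h \<in> K \<Longrightarrow> \<tau> g \<circ> \<tau> h = \<tau> (g + h)"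
    and \<tau>_one: "g \<in> K \<Longrightarrow> \<tau> g 1 = 1"
    and \<tau>_contraction: "g \<in> K \<Longrightarrow> \<omega> (adj (\<tau> g A) * \<tau> g A) \<le> \<omega> (adj A * A)"
    and \<tau>_measurable:
      "(\<lambda>g. \<omega> (adj A * \<tau> g B)) \<in> borel_measurable (restrict_space borel K)"


subsection \<open>Nets\<close>

definition directed_set :: "'i set \<Rightarrow> ('i \<Rightarrow> 'i \<Rightarrow> bool) \<Rightarrow> bool" where
  "directed_set I le \<longleftrightarrow> I \<noteq> {} \<and> reflp_on I le \<and> transp_on I le \<and>
     (\<forall>a\<in>I. \<forall>b\<in>I. \<exists>c\<in>I. le a c \<and> le b c)"

definition net_filter :: "'i set \<Rightarrow> ('i \<Rightarrow> 'i \<Rightarrow> bool) \<Rightarrow> 'i filter" where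
  "net_filter I le = (INF a\<in>I. principal {b \<in> I. le a b})"

lemma eventually_net_filter:
  assumes "directed_set I le"
  shows "eventually P (net_filter I le) \<longleftrightarrow> (\<exists>a\<in>I. \<forall>b\<in>I. le a b \<longrightarrow> P b)"
  unfolding net_filter_def
proof (subst eventually_INF_base)
  show "I \<noteq> {}"
    using assms by (simp add: directed_set_def)
next
  fix a b assume ab: "a \<in> I" "b \<in> I"
  then obtain c where c: "c \<in> I" "le a c" "le b c"
    using assms unfolding directed_set_def by blast
  have "transp_on I le"
    using assms by (simp add: directed_set_def)
  then have "{d \<in> I. le c d} \<subseteq> {d \<in> I. le a d} \<inter> {d \<in> I. le b d}"
    using ab c by (auto dest: transp_onD)
  then show "\<exists>x\<in>I. principal {d \<in> I. le x d} \<le>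
      inf (principal {d \<in> I. le a d}) (principal {d \<in> I. le b d})"
    using c(1) by auto
qed (auto simp: eventually_principal)

lemma net_filter_neq_bot:
  assumes "directed_set I le"
  shows "net_filter I le \<noteq> bot"
  using assms eventually_net_filter[OF assms, of "\<lambda>_. False"]
  unfolding trivial_limit_def directed_set_def by blast

definition space_filling ::
    "'g::{topological_group_add,t2_space} measure \<Rightarrow> 'g set \<Rightarrow>
     'i set \<Rightarrow> ('i \<Rightarrow> 'i \<Rightarrow> bool) \<Rightarrow> ('i \<Rightarrow> 'g set) \<Rightarrow> bool" where
  "space_filling M K I le \<Lambda> \<longleftrightarrow>
     directed_set I le \<and>
     (\<forall>\<alpha>\<in>I. \<Lambda> \<alpha> \<in> sets borel \<and> \<Lambda> \<alpha> \<subseteq> K \<and> emeasure M (\<Lambda> \<alpha>) < \<infinity>) \<and>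
     (\<exists>\<alpha>\<^sub>1\<in>I. \<forall>\<alpha>\<in>I. le \<alpha>\<^sub>1 \<alpha> \<longrightarrow> 0 < emeasure M (\<Lambda> \<alpha>)) \<and>
     (\<forall>g\<in>K. ((\<lambda>\<alpha>. measure M (sym_diff (\<Lambda> \<alpha>) ((\<lambda>k. k + g) ` \<Lambda> \<alpha>)) / measure M (\<Lambda> \<alpha>))
        \<longlongrightarrow> 0) (net_filter I le))"

end

theory Submission
  imports Defs
begin

text \<open>
  Write \<open>\<langle>x, y\<rangle> = \<omega>(x\<^sup>*y)\<close> and consider the set \<open>S\<close> of all \<open>x\<close> whose averages
  \<open>\<mu>(\<Lambda>\<^sub>\<alpha>)\<^sup>-\<^sup>1 \<integral> \<langle>A, \<tau>\<^bsub>hg\<^esub> x\<rangle> d\<mu>(g)\<close> over \<open>\<Lambda>\<^sub>\<alpha>\<close> agree with those of \<open>B\<close> in the limit, uniformly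
  in \<open>h \<in> K \<union> {1}\<close>. It is convex, contains \<open>B\<close>, and is invariant under every \<open>\<tau>\<^sub>k\<close>, because right
  translation by \<open>k\<close> changes the average only by the relative measure of \<open>\<Lambda>\<^sub>\<alpha> \<Delta> \<Lambda>\<^sub>\<alpha>k\<close>. If \<open>c \<in> S\<close>
  nearly minimises \<open>\<langle>c, c\<rangle>\<close> over \<open>S\<close>, then the parallelogram law, applied to \<open>c\<close> and \<open>\<tau>\<^sub>k c\<close>, shows
  that \<open>c\<close> is nearly fixed by all \<open>\<tau>\<^sub>k\<close>, so that its averages, and hence eventually
  those of \<open>B\<close>, are close to \<open>\<langle>A, c\<rangle>\<close> for all \<open>h\<close> at once. Left invariance identifies the average
  for \<open>h\<close> with the average over \<open>h\<Lambda>\<^sub>\<alpha>\<close>. This replaces the mean ergodic theorem in the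
  completion of the GNS space.
\<close>

subsection \<open>Limits and set integrals\<close>

text \<open>This yields a limit that is not known in advance. The approximate values for the errors
  \<open>1/(n+1)\<close> form a Cauchy sequence, because any two of them are close to a common value
  \<open>f x\<close>; its limit is then the limit of \<open>f\<close>.\<close>

lemma tendsto_complete_if_eventually_near:
  fixes f :: "'b \<Rightarrow> 'c::complete_space"
  assumes F: "F \<noteq> bot"
    and near: "\<And>e. e > 0 \<Longrightarrow> \<exists>z. \<forall>\<^sub>F x in F. dist (f x) z \<le> e"
  shows "\<exists>L. (f \<longlongrightarrow> L) F"
proof -
  have "\<exists>z. \<forall>\<^sub>F x in F. dist (f x) z \<le> inverse (real (Suc n))" for n
    by (rule near) simp
  then obtain z where z: "\<And>n. \<forall>\<^sub>F x in F. dist (f x) (z n) \<le> inverse (real (Suc n))"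
    by metis
  have zz: "dist (z m) (z n) \<le> inverse (real (Suc m)) + inverse (real (Suc n))" for m n
  proof -
    have "\<forall>\<^sub>F x in F. dist (z m) (z n) \<le> inverse (real (Suc m)) + inverse (real (Suc n))"
      using z[of m] z[of n]
    proof eventually_elim
      case (elim x)
      then show ?case
        using dist_triangle3[of "z m" "z n" "f x"] by simp
    qed
    \<comment> \<open>The inequality does not mention \<open>x\<close>, so holding eventually along
      a nontrivial filter makes it true.\<close>
    then show ?thesis
      using F by simp
  qed
  have "Cauchy z"
  proof (rule metric_CauchyI)
    fix e :: real assume "e > 0"
    then obtain N where N: "inverse (real (Suc N)) < e / 2"
      using reals_Archimedean[of "e / 2"] by auto
    have "dist (z m) (z n) < e" if "m \<ge> N" "n \<ge> N" for m n
    proof -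
      have "inverse (real (Suc m)) \<le> inverse (real (Suc N))"
        "inverse (real (Suc n)) \<le> inverse (real (Suc N))"
        using that by (simp_all add: le_imp_inverse_le)
      then show ?thesis
        using zz[of m n] N by linarith
    qed
    then show "\<exists>N. \<forall>m\<ge>N. \<forall>n\<ge>N. dist (z m) (z n) < e"
      by blast
  qed
  then obtain L where L: "z \<longlonglongrightarrow> L"
    using Cauchy_convergent convergent_def by blast
  have "(f \<longlongrightarrow> L) F"
  proof (rule tendstoI)
    fix e :: real assume e: "e > 0"
    obtain N where N: "inverse (real (Suc N)) < e / 2"
      using reals_Archimedean[of "e / 2"] e by auto
    obtain N' where N': "\<And>n. n \<ge> N' \<Longrightarrow> dist (z n) L < e / 2"
      using L e unfolding lim_sequentially by (meson half_gt_zero)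
    define n where "n = max N N'"
    have n: "inverse (real (Suc n)) \<le> inverse (real (Suc N))"
      unfolding n_def by (simp add: le_imp_inverse_le)
    show "\<forall>\<^sub>F x in F. dist (f x) L < e"
      using z[of n]
    proof eventually_elim
      case (elim x)
      have "dist (z n) L < e / 2"
        by (rule N') (simp add: n_def)
      then show ?case
        using elim n N dist_triangle[of "f x" L "z n"] by linarith
    qed
  qed
  then show ?thesis ..
qed

section \<open>Bounds and change of variables for set integrals\<close>

lemma set_integrable_bounded:
  fixes f :: "'b \<Rightarrow> 'c::{banach,second_countable_topology}"
  assumes "X \<in> sets M" "emeasure M X < \<infinity>" "set_borel_measurable M X f"
    and "\<And>x. x \<in> X \<Longrightarrow> norm (f x) \<le> C"
  shows "set_integrable M X f"
  using assms unfolding set_integrable_def set_borel_measurable_def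
  by (intro integrableI_bounded_set[where A = X and B = C]) auto

lemma norm_integral_le_integral:
  fixes f :: "'b \<Rightarrow> 'c::{banach,second_countable_topology}"
  assumes "integrable M f" "integrable M g" "\<And>x. x \<in> space M \<Longrightarrow> norm (f x) \<le> g x"
  shows "norm (LINT x|M. f x) \<le> (LINT x|M. g x)"
  using assms by (intro order_trans[OF integral_norm_bound] integral_mono) auto

text \<open>The contributions of \<open>X \<inter> Y\<close> cancel: the difference of the two
  indicators vanishes off the symmetric difference and has modulus 1 on it.\<close>

lemma norm_set_integral_diff_le:
  fixes f :: "'b \<Rightarrow> 'c::{banach,second_countable_topology}"
  assumes X: "X \<in> sets M" "emeasure M X < \<infinity>" "set_integrable M X f"
    and Y: "Y \<in> sets M" "emeasure M Y < \<infinity>" "set_integrable M Y f"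
    and C: "\<And>x. x \<in> X \<union> Y \<Longrightarrow> norm (f x) \<le> C"
  shows "norm ((LINT x:X|M. f x) - (LINT x:Y|M. f x)) \<le> C * measure M (sym_diff X Y)"
proof -
  have fin: "sym_diff X Y \<in> sets M" "emeasure M (sym_diff X Y) < \<infinity>"
  proof -
    show "sym_diff X Y \<in> sets M"
      using X Y by auto
    have "emeasure M (sym_diff X Y) \<le> emeasure M (X \<union> Y)"
      using X Y by (intro emeasure_mono) auto
    also have "\<dots> \<le> emeasure M X + emeasure M Y"
      using X Y by (intro emeasure_subadditive)
    also have "\<dots> < \<infinity>"
      using X Y by simp
    finally show "emeasure M (sym_diff X Y) < \<infinity>" .
  qed
  have "(LINT x:X|M. f x) - (LINT x:Y|M. f x) =
      (LINT x|M. indicator X x *\<^sub>R f x - indicator Y x *\<^sub>R f x)"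
    using X Y unfolding set_lebesgue_integral_def set_integrable_def by simp
  also have "norm \<dots> \<le> (LINT x|M. C * indicator (sym_diff X Y) x)"
  proof (rule norm_integral_le_integral)
    show "integrable M (\<lambda>x. indicator X x *\<^sub>R f x - indicator Y x *\<^sub>R f x)"
      using X Y unfolding set_integrable_def by simp
    show "integrable M (\<lambda>x. C * indicator (sym_diff X Y) x :: real)"
      using fin by simp
    show "norm (indicator X x *\<^sub>R f x - indicator Y x *\<^sub>R f x) \<le> C * indicator (sym_diff X Y) x"
      for x
      using C[of x] by (auto simp: indicator_def)
  qed
  also have "\<dots> = C * measure M (sym_diff X Y)"
    using fin sets.sets_into_space[OF fin(1)] by (simp add: Int_absorb2)
  finally show ?thesis .
qed

text \<open>Images under \<open>p\<close> are preimages under the continuous inverse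
  \<open>q\<close>, hence Borel. Invariance on Borel sets says that \<open>distr M M p = M\<close>,
  and the integral formula is the change of variables for this push-forward. Left and right
  translations are both instances.\<close>

lemma
  fixes M :: "'b::topological_space measure"
    and f :: "'b \<Rightarrow> 'c::{banach,second_countable_topology}"
  assumes M: "sets M = sets borel"
    and hom: "homeomorphism UNIV UNIV p q"
    and X: "X \<in> sets borel"
  shows borel_image_homeomorphism: "p ` X \<in> sets borel"
    and set_integral_image_homeomorphism:
      "\<lbrakk>\<And>B. B \<in> sets borel \<Longrightarrow> emeasure M (p ` B) = emeasure M B;
        set_borel_measurable M (p ` X) f\<rbrakk>
       \<Longrightarrow> (LINT x:p ` X|M. f x) = (LINT x:X|M. f (p x))"
proof -
  have pq: "p (q x) = x" "q (p x) = x" for x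
    using hom by (auto simp: homeomorphism_def)
  have "continuous_on UNIV p" "continuous_on UNIV q"
    using hom by (auto simp: homeomorphism_def)
  then have meas: "p \<in> borel_measurable borel" "q \<in> borel_measurable borel"
    by (auto intro: borel_measurable_continuous_onI)
  have "p ` X = q -` X \<inter> space borel"
    using pq by (auto simp: image_iff) (metis pq(1))
  then show "p ` X \<in> sets borel"
    using measurable_sets[OF meas(2) X] by simp
  assume inv: "\<And>B. B \<in> sets borel \<Longrightarrow> emeasure M (p ` B) = emeasure M B"
    and f: "set_borel_measurable M (p ` X) f"
  have p: "p \<in> measurable M M"
    using meas(1) M by (simp cong: measurable_cong_sets)
  have "distr M M p = M"
  proof (rule measure_eqI)
    fix B assume "B \<in> sets (distr M M p)"
    then have B: "B \<in> sets M"
      by simp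
    have sp: "space M = UNIV"
      using sets_eq_imp_space_eq[OF M] by simp
    have "p -` B \<in> sets borel"
      using measurable_sets[OF p B] by (simp add: M sp)
    moreover have "p ` (p -` B) = B"
      using pq(1) by (auto simp: image_iff) (metis pq(1))
    ultimately have "emeasure M (p -` B) = emeasure M B"
      using inv by metis
    then show "emeasure (distr M M p) B = emeasure M B"
      by (simp add: emeasure_distr[OF p B] sp)
  qed simp
  then have "(LINT x:p ` X|M. f x) = (LINT x|distr M M p. indicator (p ` X) x *\<^sub>R f x)"
    by (simp add: set_lebesgue_integral_def)
  also have "\<dots> = (LINT x|M. indicator (p ` X) (p x) *\<^sub>R f (p x))"
    using f p unfolding set_borel_measurable_def by (intro integral_distr)
  also have "\<dots> = (LINT x:X|M. f (p x))"
  proof -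
    have "p x \<in> p ` X \<longleftrightarrow> x \<in> X" for x
      using pq(2) by (metis image_iff)
    then show ?thesis
      unfolding set_lebesgue_integral_def by (simp add: indicator_def)
  qed
  finally show "(LINT x:p ` X|M. f x) = (LINT x:X|M. f (p x))" .
qed

section \<open>Translations and invariance of Haar measures\<close>

lemma homeomorphism_add_left:
  "homeomorphism UNIV UNIV ((+) h) ((+) (- h :: 'g::topological_group_add))"
  by (auto simp: homeomorphism_def add.assoc[symmetric] intro!: continuous_intros)

lemma homeomorphism_add_right:
  "homeomorphism UNIV UNIV (\<lambda>k. k + h) (\<lambda>k. k + (- h :: 'g::topological_group_add))"
  by (auto simp: homeomorphism_def add.assoc intro!: continuous_intros)

lemma
  assumes "right_haar_measure M"
  shows right_haar_measure_sets: "sets M = sets borel"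
    and emeasure_right_translate: "B \<in> sets borel \<Longrightarrow> emeasure M ((\<lambda>k. k + g) ` B) = emeasure M B"
  using assms by (auto simp: right_haar_measure_def radon_measure_def)

lemma emeasure_left_translate:
  assumes "left_haar_measure M" "B \<in> sets borel"
  shows "emeasure M ((+) g ` B) = emeasure M B"
  using assms by (simp add: left_haar_measure_def)


subsection \<open>The semi-gns_inner product of a state\<close>

context star_algebra_state
begin

text \<open>The sesquilinear form of the GNS construction, conjugate-linear in the first argument.
  It may be degenerate, so \<open>norm_sq\<close> is the square of a seminorm only.\<close>

definition gns_inner :: "'a \<Rightarrow> 'a \<Rightarrow> complex" where
  "gns_inner x y = \<omega> (adj x * y)"

definition norm_sq :: "'a \<Rightarrow> real" where
  "norm_sq x = Re (gns_inner x x)"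

lemma gns_inner_add_right: "gns_inner x (y + z) = gns_inner x y + gns_inner x z"
  unfolding gns_inner_def using state_linear
  by (simp add: distrib_left Vector_Spaces.linear_iff)

lemma gns_inner_scale_right: "gns_inner x (scale c y) = c * gns_inner x y"
  unfolding gns_inner_def using state_linear
  by (simp add: scale_mult_right Vector_Spaces.linear_iff)

lemma gns_inner_add_left: "gns_inner (x + y) z = gns_inner x z + gns_inner y z"
  unfolding gns_inner_def using state_linear
  by (simp add: adj_add distrib_right Vector_Spaces.linear_iff)

lemma gns_inner_scale_left: "gns_inner (scale c x) y = cnj c * gns_inner x y"
  unfolding gns_inner_def using state_linear
  by (simp add: adj_scale scale_mult_left Vector_Spaces.linear_iff)

lemma gns_inner_diff_right: "gns_inner x (y - z) = gns_inner x y - gns_inner x z"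
  using gns_inner_add_right[of x "y - z" z] by simp

lemma norm_sq_nonneg: "0 \<le> norm_sq x"
  using state_nonneg[of x] by (simp add: norm_sq_def gns_inner_def less_eq_complex_def)

lemma Im_inner_self: "Im (gns_inner x x) = 0"
  using state_nonneg[of x] by (simp add: gns_inner_def less_eq_complex_def)

text \<open>Polarisation: positivity makes the form real on the diagonal. At \<open>x + y\<close>
  this makes the imaginary parts opposite, at \<open>x + scale \<i> y\<close> it makes the real
  parts equal.\<close>

lemma gns_inner_commute: "gns_inner y x = cnj (gns_inner x y)"
proof -
  have "Im (gns_inner (x + y) (x + y)) = 0" "Im (gns_inner (x + scale \<i> y) (x + scale \<i> y)) = 0"
    by (rule Im_inner_self)+
  then show ?thesis
    by (auto simp: gns_inner_add_left gns_inner_add_right gns_inner_scale_left gns_inner_scale_right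
        Im_inner_self complex_eq_iff)
qed

lemma norm_sq_scale: "norm_sq (scale c x) = (cmod c)\<^sup>2 * norm_sq x"
proof -
  have "gns_inner (scale c x) (scale c x) = complex_of_real ((cmod c)\<^sup>2) * gns_inner x x"
    unfolding complex_norm_square by (simp add: gns_inner_scale_left gns_inner_scale_right)
  then show ?thesis
    by (simp add: norm_sq_def)
qed

lemma norm_sq_add_scale:
  "norm_sq (x + scale c y) = norm_sq x + 2 * Re (c * gns_inner x y) + (cmod c)\<^sup>2 * norm_sq y"
proof -
  have "norm_sq (x + scale c y) =
      norm_sq x + Re (gns_inner x (scale c y)) + Re (gns_inner (scale c y) x) + norm_sq (scale c y)"
    unfolding norm_sq_def by (simp add: gns_inner_add_left gns_inner_add_right)
  then show ?thesis
    by (simp add: norm_sq_scale gns_inner_commute[of "scale c y" x] gns_inner_scale_right)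
qed

lemma parallelogram: "norm_sq (x + y) + norm_sq (x - y) = 2 * norm_sq x + 2 * norm_sq y"
  using norm_sq_add_scale[of x 1 y] norm_sq_add_scale[of x "-1" y] by simp

lemma gns_inner_Cauchy_Schwarz: "cmod (gns_inner x y) \<le> sqrt (norm_sq x) * sqrt (norm_sq y)"
proof -
  let ?s = "cmod (gns_inner x y)"
  \<comment> \<open>This is \<open>norm_sq (x + scale c y)\<close> with
    \<open>c = - r * cnj (gns_inner x y)\<close>; the conjugate makes the cross term real.\<close>
  have quad: "0 \<le> norm_sq x - 2 * r * ?s\<^sup>2 + r\<^sup>2 * ?s\<^sup>2 * norm_sq y" for r :: real
  proof -
    have "complex_of_real (- r) * cnj (gns_inner x y) * gns_inner x y = complex_of_real (- r * ?s\<^sup>2)"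
      unfolding of_real_mult complex_norm_square by simp
    then show ?thesis
      using norm_sq_nonneg[of "x + scale (complex_of_real (- r) * cnj (gns_inner x y)) y"]
      by (simp add: norm_sq_add_scale norm_mult power_mult_distrib del: of_real_minus)
  qed
  have "?s\<^sup>2 \<le> norm_sq x * norm_sq y"
  proof (cases "norm_sq y = 0")
    case True
    \<comment> \<open>For a null vector \<open>y\<close> the quadratic degenerates to a linear
      function of \<open>r\<close>, which a large \<open>r\<close> would make negative.\<close>
    have "?s\<^sup>2 = 0"
    proof (rule ccontr)
      assume s: "?s\<^sup>2 \<noteq> 0"
      then have "2 * ((norm_sq x + 1) / ?s\<^sup>2) * ?s\<^sup>2 = 2 * (norm_sq x + 1)"
        by simp
      then show False
        using quad[of "(norm_sq x + 1) / ?s\<^sup>2"] True norm_sq_nonneg[of x] by simp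
    qed
    then show ?thesis
      using True by simp
  next
    case False
    then have pos: "norm_sq y > 0"
      using norm_sq_nonneg[of y] by simp
    \<comment> \<open>\<open>r = 1 / norm_sq y\<close> minimises the quadratic.\<close>
    have "0 \<le> norm_sq x - ?s\<^sup>2 / norm_sq y"
      using quad[of "1 / norm_sq y"] pos by (simp add: power2_eq_square)
    then show ?thesis
      using pos by (simp add: field_simps)
  qed
  then have "?s \<le> sqrt (norm_sq x * norm_sq y)"
    by (rule real_le_rsqrt)
  then show ?thesis
    by (simp add: real_sqrt_mult)
qed

end


subsection \<open>Averages along orbits\<close>

context star_dynamical_system
begin

lemma norm_sq_\<tau>_le: "g \<in> K \<Longrightarrow> norm_sq (\<tau> g x) \<le> norm_sq x"
  using \<tau>_contraction[of g x] by (simp add: norm_sq_def gns_inner_def less_eq_complex_def)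

lemma gns_inner_\<tau>_le: "g \<in> K \<Longrightarrow> cmod (gns_inner A (\<tau> g x)) \<le> sqrt (norm_sq A) * sqrt (norm_sq x)"
  by (rule order_trans[OF gns_inner_Cauchy_Schwarz])
    (intro mult_left_mono real_sqrt_le_mono norm_sq_\<tau>_le, simp_all add: norm_sq_nonneg)

lemma translate_in_K: "h \<in> insert 0 K \<Longrightarrow> g \<in> K \<Longrightarrow> h + g \<in> K"
  using K_subsemigroup by (auto simp: subsemigroup_def)

text \<open>Translation by \<open>h\<close> is continuous and maps \<open>K\<close> into itself, so
  composing with it preserves measurability on \<open>K\<close>; extension by zero then gives a
  function on the whole group.\<close>

lemma set_borel_measurable_gns_inner_\<tau>:
  assumes M: "sets M = sets borel" and X: "X \<in> sets borel" "X \<subseteq> K" and h: "h \<in> insert 0 K"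
  shows "set_borel_measurable M X (\<lambda>g. gns_inner A (\<tau> (h + g) x))"
proof -
  have "(+) h \<in> measurable (restrict_space borel K) (restrict_space borel K)"
  proof (rule measurable_restrict_space2)
    show "(+) h \<in> space (restrict_space borel K) \<rightarrow> K"
      using translate_in_K[OF h] by (auto simp: space_restrict_space)
    show "(+) h \<in> borel_measurable (restrict_space borel K)"
      by (intro measurable_restrict_space1 borel_measurable_continuous_onI continuous_intros)
  qed
  from measurable_compose[OF this \<tau>_measurable[of A x]]
  have "(\<lambda>g. gns_inner A (\<tau> (h + g) x)) \<in> borel_measurable (restrict_space borel K)"
    by (simp add: gns_inner_def)
  then have "(\<lambda>g. indicator K g *\<^sub>R gns_inner A (\<tau> (h + g) x)) \<in> borel_measurable borel"
    using K_borel by (simp add: borel_measurable_restrict_space_iff)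
  then have "set_borel_measurable M K (\<lambda>g. gns_inner A (\<tau> (h + g) x))"
    unfolding set_borel_measurable_def using M by (simp cong: measurable_cong_sets)
  then show ?thesis
    using X M by (auto intro: set_borel_measurable_subset)
qed

lemma set_integrable_gns_inner_\<tau>:
  assumes M: "sets M = sets borel" and X: "X \<in> sets borel" "X \<subseteq> K" "emeasure M X < \<infinity>"
    and h: "h \<in> insert 0 K"
  shows "set_integrable M X (\<lambda>g. gns_inner A (\<tau> (h + g) x))"
  using assms by (intro gns_inner_\<tau>_le translate_in_K
      set_integrable_bounded[OF _ _ set_borel_measurable_gns_inner_\<tau>,
        where C = "sqrt (norm_sq A) * sqrt (norm_sq x)"]) auto

text \<open>The shift by \<open>h\<close> sits in the integrand rather than in the domain, so that
  all \<open>h\<close> share the set \<open>X\<close>. If \<open>measure M X = 0\<close>, the value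
  is 0.\<close>

definition orbit_average :: "'g measure \<Rightarrow> 'a \<Rightarrow> 'g set \<Rightarrow> 'g \<Rightarrow> 'a \<Rightarrow> complex" where
  "orbit_average M A X h x = (1 / measure M X) *\<^sub>R (LINT g:X|M. gns_inner A (\<tau> (h + g) x))"

lemma orbit_average_add:
  assumes "sets M = sets borel" "X \<in> sets borel" "X \<subseteq> K" "emeasure M X < \<infinity>" "h \<in> insert 0 K"
  shows "orbit_average M A X h (x + y) = orbit_average M A X h x + orbit_average M A X h y"
proof -
  have "(LINT g:X|M. gns_inner A (\<tau> (h + g) (x + y))) =
      (LINT g:X|M. gns_inner A (\<tau> (h + g) x) + gns_inner A (\<tau> (h + g) y))"
    using assms \<tau>_linear translate_in_K
    by (intro set_lebesgue_integral_cong)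
      (auto simp: gns_inner_add_right[symmetric] Vector_Spaces.linear_iff subset_iff)
  then show ?thesis
    unfolding orbit_average_def
    by (simp only: scaleR_add_right set_integral_add(2)[OF
          set_integrable_gns_inner_\<tau>[OF assms] set_integrable_gns_inner_\<tau>[OF assms]])
qed

lemma orbit_average_scale:
  assumes "sets M = sets borel" "X \<in> sets borel" "X \<subseteq> K" "h \<in> insert 0 K"
  shows "orbit_average M A X h (scale c x) = c * orbit_average M A X h x"
proof -
  have "(LINT g:X|M. gns_inner A (\<tau> (h + g) (scale c x))) = (LINT g:X|M. c * gns_inner A (\<tau> (h + g) x))"
    using assms \<tau>_linear translate_in_K
    by (intro set_lebesgue_integral_cong)
      (auto simp: gns_inner_scale_right[symmetric] Vector_Spaces.linear_iff subset_iff)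
  then show ?thesis
    unfolding orbit_average_def by simp
qed

text \<open>Since \<open>\<tau> (h + g)\<close> after \<open>\<tau> k\<close> is
  \<open>\<tau> (h + g + k)\<close>, right invariance turns the average of \<open>\<tau> k x\<close>
  into an integral over \<open>X\<close> translated by \<open>k\<close> on the right. The bound does
  not depend on \<open>h\<close>, which makes the later convergence uniform.\<close>

lemma orbit_average_translate_le:
  assumes haar: "right_haar_measure M"
    and X: "X \<in> sets borel" "X \<subseteq> K" "emeasure M X < \<infinity>"
    and h: "h \<in> insert 0 K" and k: "k \<in> K"
  shows "cmod (orbit_average M A X h (\<tau> k x) - orbit_average M A X h x) \<le>
    sqrt (norm_sq A) * sqrt (norm_sq x) *
      (measure M (sym_diff X ((\<lambda>g. g + k) ` X)) / measure M X)"
proof -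
  let ?Y = "(\<lambda>g. g + k) ` X" and ?f = "\<lambda>g. gns_inner A (\<tau> (h + g) x)"
  note M = right_haar_measure_sets[OF haar]
  have Y: "?Y \<in> sets borel" "?Y \<subseteq> K" "emeasure M ?Y < \<infinity>"
    using borel_image_homeomorphism[OF M homeomorphism_add_right X(1)] X k K_subsemigroup
      emeasure_right_translate[OF haar X(1)] by (auto simp: subsemigroup_def)
  have "(LINT g:X|M. gns_inner A (\<tau> (h + g) (\<tau> k x))) = (LINT g:X|M. ?f (g + k))"
  proof (rule set_lebesgue_integral_cong)
    show "\<forall>g. g \<in> X \<longrightarrow> gns_inner A (\<tau> (h + g) (\<tau> k x)) = ?f (g + k)"
      using \<tau>_comp[OF translate_in_K[OF h] k] X(2)
      by (auto simp: fun_eq_iff add.assoc[symmetric])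
  qed (use X M in simp)
  also have "\<dots> = (LINT g:?Y|M. ?f g)"
    using set_integral_image_homeomorphism[OF M homeomorphism_add_right X(1)
        emeasure_right_translate[OF haar] set_borel_measurable_gns_inner_\<tau>[OF M Y(1,2) h]]
    by simp
  finally have "orbit_average M A X h (\<tau> k x) - orbit_average M A X h x =
      (1 / measure M X) *\<^sub>R ((LINT g:?Y|M. ?f g) - (LINT g:X|M. ?f g))"
    unfolding orbit_average_def by (simp add: scaleR_diff_right)
  moreover have "cmod ((LINT g:X|M. ?f g) - (LINT g:?Y|M. ?f g)) \<le>
      sqrt (norm_sq A) * sqrt (norm_sq x) * measure M (sym_diff X ?Y)"
    using X Y M h
    by (intro norm_set_integral_diff_le set_integrable_gns_inner_\<tau> gns_inner_\<tau>_le translate_in_K) auto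
  ultimately show ?thesis
    by (simp add: norm_minus_commute divide_right_mono)
qed

text \<open>Every \<open>h + g\<close> with \<open>g\<close> in \<open>X\<close> lies in
  \<open>K\<close>, so the integrand itself stays within \<open>e\<close> of
  \<open>gns_inner A x\<close>, whatever the shape of \<open>X\<close>.\<close>

lemma orbit_average_near_fixed_le:
  assumes M: "sets M = sets borel"
    and X: "X \<in> sets borel" "X \<subseteq> K" "emeasure M X < \<infinity>" "0 < emeasure M X"
    and h: "h \<in> insert 0 K"
    and fixed: "\<And>k. k \<in> K \<Longrightarrow> cmod (gns_inner A (\<tau> k x) - gns_inner A x) \<le> e"
  shows "cmod (orbit_average M A X h x - gns_inner A x) \<le> e"
proof -
  let ?f = "\<lambda>g. gns_inner A (\<tau> (h + g) x)" and ?c = "\<lambda>_::'g. gns_inner A x"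
  have pos: "measure M X > 0"
    using X by (simp add: measure_def enn2real_positive_iff)
  have XM: "X \<in> sets M"
    using X M by simp
  have int: "set_integrable M X ?f" "set_integrable M X ?c"
    using X XM set_integrable_gns_inner_\<tau>[OF M X(1-3) h] by (auto simp: set_integrable_def)
  have const: "(LINT g:X|M. ?c g) = measure M X *\<^sub>R gns_inner A x"
    using X XM by (simp add: set_lebesgue_integral_def sets.sets_into_space Int_absorb2)
  have "orbit_average M A X h x - gns_inner A x =
      (1 / measure M X) *\<^sub>R (LINT g:X|M. ?f g - ?c g)"
    unfolding orbit_average_def set_integral_diff(2)[OF int] const
    using pos by (simp add: scaleR_diff_right)
  moreover have "cmod (LINT g:X|M. ?f g - ?c g) \<le> e * measure M X"
  proof -
    have "norm (LINT g|M. indicator X g *\<^sub>R (?f g - ?c g)) \<le> (LINT g|M. e * indicator X g)"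
    proof (rule norm_integral_le_integral)
      show "integrable M (\<lambda>g. indicator X g *\<^sub>R (?f g - ?c g))"
        using set_integral_diff(1)[OF int] by (simp add: set_integrable_def)
      show "integrable M (\<lambda>g. e * indicator X g :: real)"
        using X XM by simp
      show "norm (indicator X g *\<^sub>R (?f g - ?c g)) \<le> e * indicator X g" for g
        using fixed[OF translate_in_K[OF h, of g]] X(2) by (auto simp: indicator_def)
    qed
    then show ?thesis
      using X XM by (simp add: set_lebesgue_integral_def sets.sets_into_space Int_absorb2)
  qed
  ultimately show ?thesis
    using pos by (simp add: field_simps)
qed

text \<open>This is where unimodularity enters: left invariance moves the shift from the integrand
  back to the domain.\<close>

lemma orbit_average_left_translate:
  assumes M: "sets M = sets borel" and haar: "left_haar_measure M"
    and X: "X \<in> sets borel" "X \<subseteq> K" and h: "h \<in> K"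
  shows "orbit_average M A X h x = (1 / measure M X) *\<^sub>R (LINT g:(+) h ` X|M. gns_inner A (\<tau> g x))"
proof -
  have "(+) h ` X \<in> sets borel" "(+) h ` X \<subseteq> K"
    using borel_image_homeomorphism[OF M homeomorphism_add_left X(1)] X h K_subsemigroup
    by (auto simp: subsemigroup_def)
  then have "set_borel_measurable M ((+) h ` X) (\<lambda>g. gns_inner A (\<tau> g x))"
    using set_borel_measurable_gns_inner_\<tau>[OF M, of _ 0] by simp
  from set_integral_image_homeomorphism[OF M homeomorphism_add_left X(1)
      emeasure_left_translate[OF haar] this]
  show ?thesis
    by (simp add: orbit_average_def)
qed

text \<open>An approximate minimiser of \<open>norm_sq\<close> replaces the vector of least norm,
  which exists only after completion. For \<open>c\<close> within \<open>\<eta>\<close> of the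
  infimum, the parallelogram law bounds \<open>norm_sq (\<tau> k c - c)\<close> by
  \<open>4 * \<eta>\<close> for all \<open>k\<close> in \<open>K\<close> at once.\<close>

lemma near_minimiser_near_fixed:
  assumes invariant: "\<And>x k. x \<in> S \<Longrightarrow> k \<in> K \<Longrightarrow> \<tau> k x \<in> S"
    and midpoint: "\<And>x y. x \<in> S \<Longrightarrow> y \<in> S \<Longrightarrow> scale (1/2) (x + y) \<in> S"
    and "S \<noteq> {}" and e: "e > 0"
  shows "\<exists>c\<in>S. \<forall>k\<in>K. cmod (gns_inner A (\<tau> k c) - gns_inner A c) \<le> e"
proof -
  define d where "d = (INF x\<in>S. norm_sq x)"
  have bdd: "bdd_below (norm_sq ` S)"
    using norm_sq_nonneg by (intro bdd_belowI2)
  have d_le: "d \<le> norm_sq x" if "x \<in> S" for x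
    unfolding d_def using bdd that by (rule cINF_lower)
  \<comment> \<open>The summand 1 keeps \<open>a\<close> positive for null vectors \<open>A\<close>;
    \<open>\<eta>\<close> is chosen so that \<open>sqrt (4 * \<eta>) = e / a\<close>.\<close>
  define a where "a = sqrt (norm_sq A) + 1"
  define \<eta> where "\<eta> = (e / (2 * a))\<^sup>2"
  have a: "a > 0"
    unfolding a_def using norm_sq_nonneg[of A] by (intro add_nonneg_pos) auto
  then have "\<eta> > 0"
    unfolding \<eta>_def using e by simp
  then obtain c where c: "c \<in> S" "norm_sq c < d + \<eta>"
    using cINF_less_iff[OF \<open>S \<noteq> {}\<close> bdd, of "d + \<eta>"] unfolding d_def by auto
  have "cmod (gns_inner A (\<tau> k c) - gns_inner A c) \<le> e" if k: "k \<in> K" for k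
  proof -
    \<comment> \<open>Half of this sum is a midpoint of two elements of \<open>S\<close>, and
      halving divides \<open>norm_sq\<close> by 4.\<close>
    have "4 * d \<le> norm_sq (\<tau> k c + c)"
      using d_le[OF midpoint[OF invariant[OF c(1) k] c(1)]]
      by (simp add: norm_sq_scale power2_eq_square norm_divide)
    then have "norm_sq (\<tau> k c - c) \<le> 4 * \<eta>"
      using parallelogram[of "\<tau> k c" c] norm_sq_\<tau>_le[OF k, of c] c(2) by simp
    then have "sqrt (norm_sq (\<tau> k c - c)) \<le> sqrt (4 * \<eta>)"
      by simp
    also have "\<dots> = e / a"
      unfolding \<eta>_def using a e by (simp add: real_sqrt_mult)
    finally have "sqrt (norm_sq A) * sqrt (norm_sq (\<tau> k c - c)) \<le> a * (e / a)"
      unfolding a_def using norm_sq_nonneg by (intro mult_mono) auto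
    also have "\<dots> = e"
      using a by simp
    finally show ?thesis
      using gns_inner_Cauchy_Schwarz[of A "\<tau> k c - c"] by (simp add: gns_inner_diff_right)
  qed
  then show ?thesis
    using c(1) by blast
qed

text \<open>A single \<open>z\<close>, namely \<open>gns_inner A c\<close> for a nearly fixed
  \<open>c\<close>, and a single tail of the net serve all \<open>h\<close>. Shrinking
  \<open>e\<close> may change \<open>c\<close>, hence \<open>z\<close>.\<close>

lemma orbit_average_eventually_near:
  fixes \<Lambda> :: "'i \<Rightarrow> 'g set"
  assumes haar: "right_haar_measure M" and sf: "space_filling M K I le \<Lambda>" and e: "e > 0"
  shows "\<exists>z. \<forall>\<^sub>F \<alpha> in net_filter I le.
    \<forall>h\<in>insert 0 K. cmod (orbit_average M A (\<Lambda> \<alpha>) h B - z) \<le> e"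
proof -
  let ?F = "net_filter I le" and ?avg = "\<lambda>\<alpha>. orbit_average M A (\<Lambda> \<alpha>)"
  note M = right_haar_measure_sets[OF haar]
  have dir: "directed_set I le"
    and \<Lambda>: "\<And>\<alpha>. \<alpha> \<in> I \<Longrightarrow> \<Lambda> \<alpha> \<in> sets borel \<and> \<Lambda> \<alpha> \<subseteq> K \<and> emeasure M (\<Lambda> \<alpha>) < \<infinity>"
    and \<Lambda>_pos: "\<forall>\<^sub>F \<alpha> in ?F. 0 < emeasure M (\<Lambda> \<alpha>)"
    and folner: "\<And>g. g \<in> K \<Longrightarrow>
      ((\<lambda>\<alpha>. measure M (sym_diff (\<Lambda> \<alpha>) ((\<lambda>k. k + g) ` \<Lambda> \<alpha>)) / measure M (\<Lambda> \<alpha>)) \<longlongrightarrow> 0) ?F"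
    using sf eventually_net_filter[of I le] by (auto simp: space_filling_def)
  have ev_I: "\<forall>\<^sub>F \<alpha> in ?F. \<alpha> \<in> I"
    using dir by (auto simp: eventually_net_filter directed_set_def)
  \<comment> \<open>Averages are compared with those of \<open>B\<close>, not with a limit, so no
    convergence is presupposed.\<close>
  define S where "S = {x. \<forall>\<epsilon>>0. \<forall>\<^sub>F \<alpha> in ?F. \<forall>h\<in>insert 0 K. cmod (?avg \<alpha> h x - ?avg \<alpha> h B) \<le> \<epsilon>}"
  have S: "\<forall>\<^sub>F \<alpha> in ?F. \<forall>h\<in>insert 0 K. cmod (?avg \<alpha> h x - ?avg \<alpha> h B) \<le> \<epsilon>"
    if "x \<in> S" "\<epsilon> > 0" for x \<epsilon>
    using that by (simp add: S_def)
  have S_invariant: "\<tau> k x \<in> S" if x: "x \<in> S" and k: "k \<in> K" for x k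
    unfolding S_def
  proof (intro CollectI allI impI)
    fix \<epsilon> :: real assume \<epsilon>: "\<epsilon> > 0"
    have "((\<lambda>\<alpha>. sqrt (norm_sq A) * sqrt (norm_sq x) *
        (measure M (sym_diff (\<Lambda> \<alpha>) ((\<lambda>g. g + k) ` \<Lambda> \<alpha>)) / measure M (\<Lambda> \<alpha>))) \<longlongrightarrow> 0) ?F"
      by (rule tendsto_mult_right_zero[OF folner[OF k]])
    then have "\<forall>\<^sub>F \<alpha> in ?F. sqrt (norm_sq A) * sqrt (norm_sq x) *
        (measure M (sym_diff (\<Lambda> \<alpha>) ((\<lambda>g. g + k) ` \<Lambda> \<alpha>)) / measure M (\<Lambda> \<alpha>)) < \<epsilon> / 2"
      using \<epsilon> by (intro order_tendstoD(2)) auto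
    then show "\<forall>\<^sub>F \<alpha> in ?F. \<forall>h\<in>insert 0 K. cmod (?avg \<alpha> h (\<tau> k x) - ?avg \<alpha> h B) \<le> \<epsilon>"
      using ev_I S[OF x half_gt_zero[OF \<epsilon>]]
    proof eventually_elim
      case (elim \<alpha>)
      show ?case
      proof
        fix h assume h: "h \<in> insert 0 K"
        have "cmod (?avg \<alpha> h (\<tau> k x) - ?avg \<alpha> h x) < \<epsilon> / 2"
          by (rule order.strict_trans1[OF orbit_average_translate_le[OF haar _ _ _ h k] elim(1)])
            (use \<Lambda>[OF elim(2)] in simp_all)
        moreover have "cmod (?avg \<alpha> h x - ?avg \<alpha> h B) \<le> \<epsilon> / 2"
          using elim(3) h by blast
        ultimately show "cmod (?avg \<alpha> h (\<tau> k x) - ?avg \<alpha> h B) \<le> \<epsilon>"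
          by (intro norm_diff_triangle_le[of _ "?avg \<alpha> h x" "\<epsilon> / 2" _ "\<epsilon> / 2", simplified]) auto
      qed
    qed
  qed
  have S_midpoint: "scale (1/2) (x + y) \<in> S" if x: "x \<in> S" and y: "y \<in> S" for x y
    unfolding S_def
  proof (intro CollectI allI impI)
    fix \<epsilon> :: real assume \<epsilon>: "\<epsilon> > 0"
    show "\<forall>\<^sub>F \<alpha> in ?F. \<forall>h\<in>insert 0 K. cmod (?avg \<alpha> h (scale (1/2) (x + y)) - ?avg \<alpha> h B) \<le> \<epsilon>"
      using ev_I S[OF x \<epsilon>] S[OF y \<epsilon>]
    proof eventually_elim
      case (elim \<alpha>)
      show ?case
      proof
        fix h assume h: "h \<in> insert 0 K"
        let ?u = "?avg \<alpha> h x - ?avg \<alpha> h B" and ?v = "?avg \<alpha> h y - ?avg \<alpha> h B"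
        \<comment> \<open>By linearity the error of the midpoint is the mean of the two
          errors.\<close>
        have "?avg \<alpha> h (scale (1/2) (x + y)) - ?avg \<alpha> h B = (?u + ?v) / 2"
          using \<Lambda>[OF elim(1)] h
          by (simp add: orbit_average_scale[OF M] orbit_average_add[OF M] field_simps)
        moreover have "cmod (?u + ?v) \<le> \<epsilon> + \<epsilon>"
          using elim(2,3) h by (intro norm_triangle_mono) blast+
        ultimately show "cmod (?avg \<alpha> h (scale (1/2) (x + y)) - ?avg \<alpha> h B) \<le> \<epsilon>"
          by (simp only: norm_divide) simp
      qed
    qed
  qed
  have "S \<noteq> {}"
    unfolding S_def by (auto intro!: exI[of _ B])
  from near_minimiser_near_fixed[OF S_invariant S_midpoint this half_gt_zero[OF e], of A]
  obtain c where c: "c \<in> S"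
    "\<And>k. k \<in> K \<Longrightarrow> cmod (gns_inner A (\<tau> k c) - gns_inner A c) \<le> e / 2"
    by blast
  have "\<forall>\<^sub>F \<alpha> in ?F. \<forall>h\<in>insert 0 K. cmod (?avg \<alpha> h B - gns_inner A c) \<le> e"
    using ev_I \<Lambda>_pos S[OF c(1) half_gt_zero[OF e]]
  proof eventually_elim
    case (elim \<alpha>)
    show ?case
    proof
      fix h assume h: "h \<in> insert 0 K"
      have "cmod (?avg \<alpha> h c - gns_inner A c) \<le> e / 2"
        using orbit_average_near_fixed_le[OF M _ _ _ elim(2) h c(2)] \<Lambda>[OF elim(1)] by blast
      moreover have "cmod (?avg \<alpha> h B - ?avg \<alpha> h c) \<le> e / 2"
        using elim(3) h by (subst norm_minus_commute) blast
      ultimately show "cmod (?avg \<alpha> h B - gns_inner A c) \<le> e"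
        by (intro norm_diff_triangle_le[of _ "?avg \<alpha> h c" "e / 2" _ "e / 2", simplified]) auto
    qed
  qed
  then show ?thesis ..
qed

end

theorem theorem3p5:
  fixes M :: "'g::{topological_group_add,t2_space} measure"
    and scale :: "complex \<Rightarrow> 'a::ring_1 \<Rightarrow> 'a"
    and adj :: "'a \<Rightarrow> 'a"
    and \<omega> :: "'a \<Rightarrow> complex"
    and \<tau> :: "'g \<Rightarrow> 'a \<Rightarrow> 'a"
    and K :: "'g set"
    and I :: "'i set"
    and le :: "'i \<Rightarrow> 'i \<Rightarrow> bool"
    and \<Lambda> :: "'i \<Rightarrow> 'g set"
    and A B :: 'a
  assumes "locally compact (UNIV :: 'g set)"
    and "right_haar_measure M"
    and "left_haar_measure M"
    and "star_dynamical_system scale adj \<omega> \<tau> K"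
    and "space_filling M K I le \<Lambda>"
  shows "\<exists>L. ((\<lambda>\<alpha>. (1 / measure M (\<Lambda> \<alpha>)) *\<^sub>R (LINT g:\<Lambda> \<alpha>|M. \<omega> (adj A * \<tau> g B)))
              \<longlongrightarrow> L) (net_filter I le) \<and>
    (\<forall>\<epsilon>>0. \<exists>\<alpha>\<^sub>0\<in>I. 0 < emeasure M (\<Lambda> \<alpha>\<^sub>0) \<and>
      (\<forall>h\<in>K. cmod ((1 / measure M (\<Lambda> \<alpha>\<^sub>0)) *\<^sub>R
                  (LINT g:((\<lambda>k. h + k) ` \<Lambda> \<alpha>\<^sub>0)|M. \<omega> (adj A * \<tau> g B))) > cmod L - \<epsilon>))"
proof -
  interpret star_dynamical_system scale adj \<omega> \<tau> K
    by fact
  let ?F = "net_filter I le" and ?avg = "\<lambda>\<alpha> h. orbit_average M A (\<Lambda> \<alpha>) h B"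
  note M = right_haar_measure_sets[OF assms(2)]
  note near = orbit_average_eventually_near[OF assms(2,5), of _ A B]
  have dir: "directed_set I le"
    and \<Lambda>: "\<And>\<alpha>. \<alpha> \<in> I \<Longrightarrow> \<Lambda> \<alpha> \<in> sets borel \<and> \<Lambda> \<alpha> \<subseteq> K"
    and \<Lambda>_pos: "\<forall>\<^sub>F \<alpha> in ?F. 0 < emeasure M (\<Lambda> \<alpha>)"
    using assms(5) eventually_net_filter[of I le] by (auto simp: space_filling_def)
  have ev_I: "\<forall>\<^sub>F \<alpha> in ?F. \<alpha> \<in> I"
    using dir by (auto simp: eventually_net_filter directed_set_def)
  note nbot = net_filter_neq_bot[OF dir]
  \<comment> \<open>The limit exists by the instance \<open>h = 0\<close> of the uniform
    estimate.\<close>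
  have "\<exists>L. ((\<lambda>\<alpha>. ?avg \<alpha> 0) \<longlongrightarrow> L) ?F"
  proof (rule tendsto_complete_if_eventually_near[OF nbot])
    fix e :: real assume "e > 0"
    then obtain z where "\<forall>\<^sub>F \<alpha> in ?F. \<forall>h\<in>insert 0 K. cmod (?avg \<alpha> h - z) \<le> e"
      using near by blast
    then have "\<forall>\<^sub>F \<alpha> in ?F. dist (?avg \<alpha> 0) z \<le> e"
      by (rule eventually_mono) (simp add: dist_norm)
    then show "\<exists>z. \<forall>\<^sub>F \<alpha> in ?F. dist (?avg \<alpha> 0) z \<le> e" ..
  qed
  then obtain L where L: "((\<lambda>\<alpha>. ?avg \<alpha> 0) \<longlongrightarrow> L) ?F" ..
  show ?thesis
  proof (intro exI[of _ L] conjI allI impI)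
    show "((\<lambda>\<alpha>. (1 / measure M (\<Lambda> \<alpha>)) *\<^sub>R (LINT g:\<Lambda> \<alpha>|M. \<omega> (adj A * \<tau> g B))) \<longlongrightarrow> L) ?F"
      using L by (simp add: orbit_average_def gns_inner_def)
  next
    fix \<epsilon> :: real assume \<epsilon>: "\<epsilon> > 0"
    \<comment> \<open>Both \<open>L\<close> and the shifted averages will lie within
      \<open>\<epsilon> / 3\<close> of \<open>z\<close>; the remaining third makes the final
      inequality strict.\<close>
    then obtain z where z: "\<forall>\<^sub>F \<alpha> in ?F. \<forall>h\<in>insert 0 K. cmod (?avg \<alpha> h - z) \<le> \<epsilon> / 3"
      using near[of "\<epsilon> / 3"] by auto
    have "\<forall>\<^sub>F \<alpha> in ?F. cmod (?avg \<alpha> 0 - z) \<le> \<epsilon> / 3"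
      using z by (rule eventually_mono) simp
    moreover have "((\<lambda>\<alpha>. cmod (?avg \<alpha> 0 - z)) \<longlongrightarrow> cmod (L - z)) ?F"
      using L by (intro tendsto_intros)
    ultimately have Lz: "cmod (L - z) \<le> \<epsilon> / 3"
      using nbot by (intro tendsto_upperbound[of _ _ ?F])
    \<comment> \<open>The quantifier over \<open>h\<close> is inside the eventual statement, so one
      index works for all of \<open>K\<close>.\<close>
    have "\<exists>\<alpha>. \<alpha> \<in> I \<and> 0 < emeasure M (\<Lambda> \<alpha>) \<and> (\<forall>h\<in>insert 0 K. cmod (?avg \<alpha> h - z) \<le> \<epsilon> / 3)"
      using eventually_conj[OF ev_I eventually_conj[OF \<Lambda>_pos z]] nbot
      by (rule eventually_happens'[rotated])
    then obtain \<alpha> where \<alpha>: "\<alpha> \<in> I" "0 < emeasure M (\<Lambda> \<alpha>)"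
      "\<And>h. h \<in> K \<Longrightarrow> cmod (?avg \<alpha> h - z) \<le> \<epsilon> / 3"
      by blast
    show "\<exists>\<alpha>\<^sub>0\<in>I. 0 < emeasure M (\<Lambda> \<alpha>\<^sub>0) \<and>
      (\<forall>h\<in>K. cmod ((1 / measure M (\<Lambda> \<alpha>\<^sub>0)) *\<^sub>R
                  (LINT g:((\<lambda>k. h + k) ` \<Lambda> \<alpha>\<^sub>0)|M. \<omega> (adj A * \<tau> g B))) > cmod L - \<epsilon>)"
    proof (intro bexI[of _ \<alpha>] conjI ballI \<alpha>)
      fix h assume h: "h \<in> K"
      have "cmod L - cmod (?avg \<alpha> h) \<le> cmod (L - ?avg \<alpha> h)"
        by (rule norm_triangle_ineq2)
      also have "\<dots> \<le> \<epsilon> / 3 + \<epsilon> / 3"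
        using Lz \<alpha>(3)[OF h] norm_minus_commute[of z "?avg \<alpha> h"]
        by (intro norm_diff_triangle_le[of _ z]) auto
      also have "\<dots> < \<epsilon>"
        using \<epsilon> by simp
      finally have "cmod L - \<epsilon> < cmod (?avg \<alpha> h)"
        by simp
      then show "cmod ((1 / measure M (\<Lambda> \<alpha>)) *\<^sub>R
          (LINT g:((\<lambda>k. h + k) ` \<Lambda> \<alpha>)|M. \<omega> (adj A * \<tau> g B))) > cmod L - \<epsilon>"
        using orbit_average_left_translate[OF M assms(3) _ _ h, of "\<Lambda> \<alpha>" A B] \<Lambda>[OF \<alpha>(1)]
        by (simp add: gns_inner_def)
    qed
  qed
qed

end
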